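(* Let $Q=(\tfrac13,\tfrac59,\tfrac59,\tfrac59)$ and $M_Q^5=\mu^{-1}(Q)\subset G_{4,2}$. Viewed in the Plücker chart $M_{23}\cong\mathbb{C}^4=\mathbb{R}^8$, the manifold $M_Q^5$ is a complete intersection in $\mathbb{R}^8$: it is the common level set $$M_Q^5=f_1^{-1}(0)\cap f_2^{-1}(-1)\cap f_3^{-1}(0)$$ and the Jacobian matrix of $(f_1,f_2,f_3)$ has rank $3$ at every point of $M_Q^5$.
   Context: $G_{4,2}$ is the Grassmannian of 2-dimensional complex subspaces of $\mathbb{C}^4$ with Plücker coordinates $P^{ij}$; the moment map is $\mu(L)=\big(\sum_{i<j}|P^{ij}(L)|^2(e_i+e_j)\big)/\big(\sum_{i<j}|P^{ij}(L)|^2\big)\in\mathbb{R}^4$. One has $M_Q^5\subset M_{23}=\{P^{23}\ne0\}$. The coordinates $(a_1,a_2,a_3,a_4)\in\mathbb{C}^4$ on $M_{23}$ are such that $L$ is spanned by the columns of the $4\times2$ matrix with rows $(a_1,a_3),(1,0),(0,1),(a_2,a_4)$. Write $a_k=u_k+iv_k$, $A+iB=a_1a_4-a_2a_3$, i.e. $A=u_1u_4-v_1v_4-u_2u_3+v_2v_3$, $B=u_1v_4+v_1u_4-u_2v_3-u_3v_2$. The functions on $\mathbb{R}^8$ are $$f_1=u_1^2+v_1^2+u_2^2+v_2^2-u_3^2-v_3^2-u_4^2-v_4^2,$$ $$f_2=5(u_1^2+v_1^2)+u_3^2+v_3^2-4(u_4^2+v_4^2),$$ $$f_3=4(u_1^2+v_1^2)+u_3^2+v_3^2-3(u_4^2+v_4^2)+A^2+B^2.$$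 *)

theory Defs
  imports "HOL-Analysis.Analysis"
begin

section \<open>The Grassmannian of planes in complex 4-space\<close>

definition G42 :: "(complex^4) set set"
  where "G42 = {L. vec.subspace L \<and> vec.dim L = 2}"

text \<open>A plane is represented by a matrix with four rows and two columns whose columns span it.
  The choice of the matrix matters only up to a common nonzero factor of all the minors, see
  \<open>minors_same_span\<close> below.\<close>

definition frame :: "(complex^4) set \<Rightarrow> complex^2^4"
  where "frame L = (SOME A. vec.span (columns A) = L)"

definition minor :: "complex^2^4 \<Rightarrow> 4 \<Rightarrow> 4 \<Rightarrow> complex"
  where "minor A i j = det (vector [A $ i, A $ j])"

definition plucker :: "4 \<Rightarrow> 4 \<Rightarrow> (complex^4) set \<Rightarrow> complex"
  where "plucker i j L = minor (frame L) i j"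

text \<open>The pairs are listed explicitly because \<open>4 = 0\<close> is the least element of the index type.\<close>

definition index_pairs :: "(4 \<times> 4) set"
  where "index_pairs = {(1,2), (1,3), (1,4), (2,3), (2,4), (3,4)}"

definition moment_map :: "(complex^4) set \<Rightarrow> real^4"
  where "moment_map L =
    (\<Sum>(i,j)\<in>index_pairs. (cmod (plucker i j L))\<^sup>2 *\<^sub>R (axis i 1 + axis j 1)) /\<^sub>R
    (\<Sum>(i,j)\<in>index_pairs. (cmod (plucker i j L))\<^sup>2)"

definition moment_fibre :: "real^4 \<Rightarrow> (complex^4) set set"
  where "moment_fibre Q = {L \<in> G42. moment_map L = Q}"

definition M23 :: "(complex^4) set set"
  where "M23 = {L \<in> G42. plucker 2 3 L \<noteq> 0}"


section \<open>The chart\<close>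

text \<open>The coordinates on \<open>\<real>\<^sup>8\<close> are ordered as \<open>u\<^sub>1, v\<^sub>1, u\<^sub>2, v\<^sub>2, u\<^sub>3, v\<^sub>3, u\<^sub>4, v\<^sub>4\<close>.\<close>

definition cplx :: "real^8 \<Rightarrow> complex^4"
  where "cplx x = vector [Complex (x$1) (x$2), Complex (x$3) (x$4),
                          Complex (x$5) (x$6), Complex (x$7) (x$8)]"

definition chart_matrix :: "complex^4 \<Rightarrow> complex^2^4"
  where "chart_matrix a = vector [vector [a$1, a$3], vector [1, 0], vector [0, 1], vector [a$2, a$4]]"

definition chart_plane :: "real^8 \<Rightarrow> (complex^4) set"
  where "chart_plane x = vec.span (columns (chart_matrix (cplx x)))"

text \<open>The coordinates of a plane, meaningful on \<^const>\<open>M23\<close> by \<open>bij_betw_chart_plane\<close> below.\<close>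

definition chart_coords :: "(complex^4) set \<Rightarrow> real^8"
  where "chart_coords = inv chart_plane"


section \<open>The defining functions\<close>

definition u :: "real^8 \<Rightarrow> 4 \<Rightarrow> real"
  where "u x k = Re (cplx x $ k)"

definition v :: "real^8 \<Rightarrow> 4 \<Rightarrow> real"
  where "v x k = Im (cplx x $ k)"

definition Apart :: "real^8 \<Rightarrow> real"
  where "Apart x = u x 1 * u x 4 - v x 1 * v x 4 - u x 2 * u x 3 + v x 2 * v x 3"

definition Bpart :: "real^8 \<Rightarrow> real"
  where "Bpart x = u x 1 * v x 4 + v x 1 * u x 4 - u x 2 * v x 3 - u x 3 * v x 2"

definition f1 :: "real^8 \<Rightarrow> real"
  where "f1 x = (u x 1)\<^sup>2 + (v x 1)\<^sup>2 + (u x 2)\<^sup>2 + (v x 2)\<^sup>2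
              - (u x 3)\<^sup>2 - (v x 3)\<^sup>2 - (u x 4)\<^sup>2 - (v x 4)\<^sup>2"

definition f2 :: "real^8 \<Rightarrow> real"
  where "f2 x = 5 * ((u x 1)\<^sup>2 + (v x 1)\<^sup>2) + (u x 3)\<^sup>2 + (v x 3)\<^sup>2 - 4 * ((u x 4)\<^sup>2 + (v x 4)\<^sup>2)"

definition f3 :: "real^8 \<Rightarrow> real"
  where "f3 x = 4 * ((u x 1)\<^sup>2 + (v x 1)\<^sup>2) + (u x 3)\<^sup>2 + (v x 3)\<^sup>2 - 3 * ((u x 4)\<^sup>2 + (v x 4)\<^sup>2)
              + (Apart x)\<^sup>2 + (Bpart x)\<^sup>2"

definition f_vec :: "real^8 \<Rightarrow> real^3"
  where "f_vec x = vector [f1 x, f2 x, f3 x]"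


section \<open>Well-definedness\<close>

lemma vec4_simps [simp]:
  "(vector [a,b,c,d] :: ('a::zero)^4) $ 1 = a"
  "(vector [a,b,c,d] :: ('a::zero)^4) $ 2 = b"
  "(vector [a,b,c,d] :: ('a::zero)^4) $ 3 = c"
  "(vector [a,b,c,d] :: ('a::zero)^4) $ 4 = d"
  by (simp_all add: vector_def)

lemma minor_eq: "minor A i j = A$i$1 * A$j$2 - A$i$2 * A$j$1"
  by (simp add: minor_def det_2)

lemma columns_2: "columns (A :: complex^2^4) = {column 1 A, column 2 A}"
proof -
  have "columns A = (\<lambda>k. column k A) ` UNIV"
    by (auto simp: columns_def)
  then show ?thesis by (simp add: UNIV_2)
qed

lemma in_span2: "x \<in> vec.span {b, c} \<longleftrightarrow> (\<exists>s t. x = s *s b + t *s c)"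
  for b c x :: "complex^4"
proof -
  have "x \<in> vec.span {b, c} \<longleftrightarrow> (\<exists>s t. x - s *s b = t *s c)"
    by (auto simp: vec.span_breakdown_eq vec.span_singleton)
  also have "\<dots> \<longleftrightarrow> (\<exists>s t. x = s *s b + t *s c)"
    by (simp add: diff_eq_eq add.commute)
  finally show ?thesis .
qed

lemma minors_subspan:
  fixes A B :: "complex^2^4"
  assumes "columns A \<subseteq> vec.span (columns B)"
  shows "\<exists>k. \<forall>i j. minor A i j = k * minor B i j"
proof -
  obtain p q where 1: "column 1 A = p *s column 1 B + q *s column 2 B"
    using assms by (auto simp: columns_2 in_span2)
  obtain r s where 2: "column 2 A = r *s column 1 B + s *s column 2 B"
    using assms by (auto simp: columns_2 in_span2)
  have a1: "A$i$1 = p * B$i$1 + q * B$i$2" for i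
    using arg_cong[OF 1, of "\<lambda>x. x$i"] by (simp add: column_def)
  have a2: "A$i$2 = r * B$i$1 + s * B$i$2" for i
    using arg_cong[OF 2, of "\<lambda>x. x$i"] by (simp add: column_def)
  have "minor A i j = (p * s - q * r) * minor B i j" for i j
    by (simp add: minor_eq a1 a2 algebra_simps)
  then show ?thesis by blast
qed

lemma minors_same_span:
  assumes "vec.span (columns A) = vec.span (columns B)"
  shows "\<exists>k. k \<noteq> 0 \<and> (\<forall>i j. minor A i j = k * minor B i j)"
proof -
  obtain k where k: "\<And>i j. minor A i j = k * minor B i j"
    using minors_subspan[of A B] assms vec.span_superset by metis
  obtain l where l: "\<And>i j. minor B i j = l * minor A i j"
    using minors_subspan[of B A] assms vec.span_superset by metis
  show ?thesis
  proof (cases "k = 0")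
    case True
    then have "minor A i j = 0" "minor B i j = 0" for i j
      using k[of i j] l[of i j] by auto
    then show ?thesis by (intro exI[of _ 1]) auto
  next
    case False
    then show ?thesis using k by blast
  qed
qed

lemma span_columns_frame:
  assumes "L \<in> G42"
  shows "vec.span (columns (frame L)) = L"
  unfolding frame_def
proof (rule someI_ex)
  from assms have L: "vec.subspace L" "vec.dim L = 2" by (auto simp: G42_def)
  obtain S where S: "S \<subseteq> L" "vec.independent S" "L \<subseteq> vec.span S" "card S = vec.dim L"
    using vec.basis_exists by blast
  then obtain b c where bc: "S = {b, c}"
    using L by (metis card_2_iff)
  define A :: "complex^2^4" where "A = (\<chi> i k. if k = 1 then b$i else c$i)"
  have "column 1 A = b" "column 2 A = c"
    by (simp_all add: A_def column_def vec_eq_iff)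
  then have "vec.span (columns A) = L"
    using S L bc by (metis columns_2 vec.span_minimal subset_antisym)
  then show "\<exists>A :: complex^2^4. vec.span (columns A) = L" by blast
qed

lemma moment_map_eq:
  assumes "L \<in> G42" "vec.span (columns A) = L"
  shows "moment_map L =
    (\<Sum>(i,j)\<in>index_pairs. (cmod (minor A i j))\<^sup>2 *\<^sub>R (axis i 1 + axis j 1)) /\<^sub>R
    (\<Sum>(i,j)\<in>index_pairs. (cmod (minor A i j))\<^sup>2)"
proof -
  obtain k where k: "k \<noteq> 0" "\<And>i j. plucker i j L = k * minor A i j"
    using minors_same_span[of "frame L" A] assms span_columns_frame[OF assms(1)]
    unfolding plucker_def by metis
  have num: "(\<Sum>(i,j)\<in>index_pairs. (cmod (plucker i j L))\<^sup>2 *\<^sub>R (axis i 1 + axis j 1)) =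
    (cmod k)\<^sup>2 *\<^sub>R (\<Sum>(i,j)\<in>index_pairs. (cmod (minor A i j))\<^sup>2 *\<^sub>R (axis i 1 + axis j 1) :: real^4)"
    unfolding scaleR_sum_right
    by (intro sum.cong) (auto simp: k norm_mult power_mult_distrib)
  have den: "(\<Sum>(i,j)\<in>index_pairs. (cmod (plucker i j L))\<^sup>2) =
    (cmod k)\<^sup>2 * (\<Sum>(i,j)\<in>index_pairs. (cmod (minor A i j))\<^sup>2)"
    unfolding sum_distrib_left
    by (intro sum.cong) (auto simp: k norm_mult power_mult_distrib)
  show ?thesis
    unfolding moment_map_def num den using k(1) by simp
qed

lemma chart_matrix_nth [simp]:
  "chart_matrix a $ 1 $ 1 = a$1" "chart_matrix a $ 1 $ 2 = a$3"
  "chart_matrix a $ 2 $ 1 = 1" "chart_matrix a $ 2 $ 2 = 0"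
  "chart_matrix a $ 3 $ 1 = 0" "chart_matrix a $ 3 $ 2 = 1"
  "chart_matrix a $ 4 $ 1 = a$2" "chart_matrix a $ 4 $ 2 = a$4"
  by (simp_all add: chart_matrix_def)

lemma dim_span2:
  fixes A :: "complex^2^4"
  assumes "minor A i j \<noteq> 0"
  shows "vec.dim (vec.span (columns A)) = 2"
proof -
  let ?b = "column 1 A" and ?c = "column 2 A"
  have ne: "?b \<notin> vec.span {?c}"
  proof
    assume "?b \<in> vec.span {?c}"
    then obtain t where t: "?b = t *s ?c" by (auto simp: vec.span_singleton)
    have "A$i$1 = t * A$i$2" for i
      using arg_cong[OF t, of "\<lambda>x. x$i"] by (simp add: column_def)
    then show False using assms by (simp add: minor_eq)
  qed
  have c0: "?c \<noteq> 0"
  proof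
    assume c: "?c = 0"
    have "A$i$2 = 0" for i
      using arg_cong[OF c, of "\<lambda>x. x$i"] by (simp add: column_def)
    then show False using assms by (simp add: minor_eq)
  qed
  have "vec.independent {?b, ?c}"
    using ne c0 by (auto simp: vec.independent_insert)
  moreover have "card {?b, ?c} = 2"
    using ne vec.span_base[of ?c "{?c}"] by (metis card_2_iff insertI1)
  ultimately show ?thesis
    by (metis columns_2 vec.dim_span_eq_card_independent)
qed

lemma chart_plane_M23: "chart_plane x \<in> M23"
proof -
  let ?A = "chart_matrix (cplx x)"
  have m: "minor ?A 2 3 = 1" by (simp add: minor_eq)
  then have G: "chart_plane x \<in> G42"
    using dim_span2[of ?A 2 3] by (simp add: chart_plane_def G42_def)
  obtain k where "k \<noteq> 0" "plucker 2 3 (chart_plane x) = k * minor ?A 2 3"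
    using minors_same_span[of "frame (chart_plane x)" ?A] span_columns_frame[OF G]
    unfolding plucker_def chart_plane_def by metis
  with m G show ?thesis by (simp add: M23_def)
qed

lemma exhaust_8:
  fixes x :: 8
  shows "x = 1 \<or> x = 2 \<or> x = 3 \<or> x = 4 \<or> x = 5 \<or> x = 6 \<or> x = 7 \<or> x = 8"
proof (induct x)
  case (of_int z)
  then have "0 \<le> z" and "z < 8" by simp_all
  then have "z = 0 \<or> z = 1 \<or> z = 2 \<or> z = 3 \<or> z = 4 \<or> z = 5 \<or> z = 6 \<or> z = 7" by arith
  then show ?case by auto
qed

lemma vec8_simps [simp]:
  "(vector [a,b,c,d,e,f,g,h] :: ('a::zero)^8) $ 1 = a"
  "(vector [a,b,c,d,e,f,g,h] :: ('a::zero)^8) $ 2 = b"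
  "(vector [a,b,c,d,e,f,g,h] :: ('a::zero)^8) $ 3 = c"
  "(vector [a,b,c,d,e,f,g,h] :: ('a::zero)^8) $ 4 = d"
  "(vector [a,b,c,d,e,f,g,h] :: ('a::zero)^8) $ 5 = e"
  "(vector [a,b,c,d,e,f,g,h] :: ('a::zero)^8) $ 6 = f"
  "(vector [a,b,c,d,e,f,g,h] :: ('a::zero)^8) $ 7 = g"
  "(vector [a,b,c,d,e,f,g,h] :: ('a::zero)^8) $ 8 = h"
  by (simp_all add: vector_def)

lemma bij_cplx: "bij cplx"
proof (rule bijI)
  show "inj cplx"
  proof (rule injI)
    fix x y assume eq: "cplx x = cplx y"
    have "cplx x $ k = cplx y $ k" for k using eq by simp
    from this[of 1] this[of 2] this[of 3] this[of 4]
    have "x$1 = y$1 \<and> x$2 = y$2 \<and> x$3 = y$3 \<and> x$4 = y$4 \<and> x$5 = y$5 \<and> x$6 = y$6 \<and> x$7 = y$7 \<and> x$8 = y$8"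
      by (simp add: cplx_def)
    then have "x $ k = y $ k" for k
      using exhaust_8[of k] by (elim disjE) (simp_all only:)
    then show "x = y" by (simp add: vec_eq_iff)
  qed
  show "surj cplx"
  proof (rule surjI)
    fix a :: "complex^4"
    show "cplx (vector [Re (a$1), Im (a$1), Re (a$2), Im (a$2),
                        Re (a$3), Im (a$3), Re (a$4), Im (a$4)]) = a"
      by (simp add: cplx_def vec_eq_iff forall_4)
  qed
qed

lemma Apart_Bpart:
  "Complex (Apart x) (Bpart x) = cplx x $ 1 * cplx x $ 4 - cplx x $ 2 * cplx x $ 3"
  by (simp add: complex_eq_iff Apart_def Bpart_def u_def v_def algebra_simps)

lemma inj_chart_plane: "inj chart_plane"
proof (rule injI)
  fix x y assume eq: "chart_plane x = chart_plane y"
  let ?A = "chart_matrix (cplx x)" and ?B = "chart_matrix (cplx y)"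
  obtain k where k: "\<And>i j. minor ?A i j = k * minor ?B i j"
    using minors_same_span[of ?A ?B] eq unfolding chart_plane_def by metis
  have "k = 1" using k[of 2 3] by (simp add: minor_eq)
  then have "cplx x = cplx y"
    using k[of 1 2] k[of 1 3] k[of 2 4] k[of 3 4] by (simp add: minor_eq vec_eq_iff forall_4)
  then show "x = y" using bij_cplx by (simp add: bij_def inj_eq)
qed

lemma surj_chart_plane:
  assumes "L \<in> M23"
  shows "\<exists>x. chart_plane x = L"
proof -
  define A where "A = frame L"
  define d where "d = minor A 2 3"
  from assms have G: "L \<in> G42" and d: "d \<noteq> 0"
    by (auto simp: M23_def plucker_def A_def d_def)
  have LA: "vec.span {column 1 A, column 2 A} = L"
    using span_columns_frame[OF G] by (simp add: A_def columns_2)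
  define b where "b = (A$3$2 / d) *s column 1 A + (- A$3$1 / d) *s column 2 A"
  define c where "c = (- A$2$2 / d) *s column 1 A + (A$2$1 / d) *s column 2 A"
  have bc: "b \<in> L" "c \<in> L"
    unfolding LA[symmetric] in_span2 b_def c_def by blast+
  have d': "d = A$2$1 * A$3$2 - A$2$2 * A$3$1" by (simp add: d_def minor_eq)
  have e: "b$2 = 1" "b$3 = 0" "c$2 = 0" "c$3 = 1"
    using d by (simp_all add: b_def c_def column_def field_simps)
      (simp_all add: d' algebra_simps)
  obtain x where x: "cplx x = vector [b$1, b$4, c$1, c$4]"
    using bij_cplx by (metis bij_pointE)
  let ?C = "chart_matrix (cplx x)"
  have "column 1 ?C = b" "column 2 ?C = c"
    by (simp_all add: column_def vec_eq_iff forall_4 e x)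
  then have "columns ?C \<subseteq> L" using bc by (simp add: columns_2)
  moreover have "vec.subspace L" "vec.dim L = 2" using G by (auto simp: G42_def)
  moreover have "vec.dim (vec.span (columns ?C)) = 2"
    by (rule dim_span2[of _ 2 3]) (simp add: minor_eq)
  ultimately have "vec.span (columns ?C) = L"
    by (intro vec.subspace_dim_equal) (simp_all add: vec.span_minimal)
  then show ?thesis by (auto simp: chart_plane_def)
qed

lemma bij_betw_chart_plane: "bij_betw chart_plane UNIV M23"
  unfolding bij_betw_def
  using inj_chart_plane chart_plane_M23 surj_chart_plane by blast

lemma chart_plane_coords: "L \<in> M23 \<Longrightarrow> chart_plane (chart_coords L) = L"
  unfolding chart_coords_def by (metis f_inv_into_f rangeI surj_chart_plane)

lemma f_vec_differentiable: "f_vec differentiable (at x)"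
proof -
  have uv: "u x 1 = x$1" "v x 1 = x$2" "u x 2 = x$3" "v x 2 = x$4"
    "u x 3 = x$5" "v x 3 = x$6" "u x 4 = x$7" "v x 4 = x$8" for x
    by (simp_all add: u_def v_def cplx_def)
  have nth: "(\<lambda>x :: real^8. x $ k) differentiable (at x)" for k
    by (rule bounded_linear_imp_differentiable) (rule bounded_linear_vec_nth)
  have f: "f1 differentiable (at x)" "f2 differentiable (at x)" "f3 differentiable (at x)"
    unfolding f1_def[abs_def] f2_def[abs_def] f3_def[abs_def] Apart_def Bpart_def uv
    by (intro derivative_intros nth)+
  have "(\<lambda>x. f_vec x $ k) differentiable (at x)" for k
    using exhaust_3[of k] f by (auto simp: f_vec_def)
  then have "(\<lambda>x. f_vec x \<bullet> i) differentiable (at x)" if "i \<in> Basis" for i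
    using that by (auto simp: Basis_vec_def inner_axis)
  then show ?thesis using differentiable_componentwise_within by blast
qed

end

theory Submission
  imports Defs
begin

text \<open>
  Everything depends only on the five numbers \<open>x\<^sub>k = |a\<^sub>k|\<^sup>2\<close> and
  \<open>D = |a\<^sub>1a\<^sub>4 - a\<^sub>2a\<^sub>3|\<^sup>2\<close>. Together with \<open>1 = |P\<^sup>2\<^sup>3|\<^sup>2\<close> they are the squared moduli
  of the minors of the chart matrix, so on the chart the equation \<open>\<mu> = Q\<close> is a linear system in
  \<open>(x, D)\<close>. As \<open>Q\<^sub>2 = Q\<^sub>3\<close>, it contains \<open>\<mu>\<^sub>2 = \<mu>\<^sub>3\<close>, which says \<open>f1 = 0\<close>. Modulo \<open>f1 = 0\<close>
  the rest says \<open>3x\<^sub>1 + x\<^sub>3 - 2x\<^sub>4 + 2D = 1\<close> and \<open>x\<^sub>3 + x\<^sub>4 + 5D = 4\<close>; five times the first minus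
  twice the second is \<open>f2 = -1\<close>, and four times the first minus the second is \<open>f3 = 0\<close>, each
  up to a factor 3 (lemma \<open>chart_plane_in_fibre_iff\<close>). The fibre lies in the chart because
  \<open>P\<^sup>2\<^sup>3\<close> is the only Pluecker coordinate that contributes to both of the components \<open>\<mu>\<^sub>2\<close>
  and \<open>\<mu>\<^sub>3\<close>: without it their sum could not exceed 1, while \<open>5/9 + 5/9 > 1\<close>
  (lemma \<open>moment_fibre_subset_M23\<close>).

  For the rank, let a covector \<open>\<lambda>\<close> annihilate the image of the Jacobian. It is tested only on
  velocities of the flows \<open>a\<^sub>k \<mapsto> exp (t\<tau>\<^sub>k) a\<^sub>k\<close> with weights
  subject to \<open>\<tau>\<^sub>1 + \<tau>\<^sub>4 = \<tau>\<^sub>2 + \<tau>\<^sub>3\<close>, that is, of the noncompact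
  part of the complex torus acting on the Grassmannian. These flows multiply each \<open>x\<^sub>k\<close> and \<open>D\<close> by
  an exponential, so the derivative of \<open>f\<close> along them can be written down (lemma
  \<open>jacobian_torus_flow\<close>), and three independent choices of weights give three linear equations
  for \<open>\<lambda>\<close> whose coefficients involve only \<open>(x, D)\<close>. On the level set they
  force \<open>\<lambda> = 0\<close> (lemma \<open>covector_eq_0\<close>). The reason that three directions suffice is that,
  for a moment map, these velocities are the gradients of its components; so at a regular
  point they are mapped onto the whole tangent space of the target.
\<close>

lemma sum_index_pairs:
  "sum g index_pairs = g (1,2) + g (1,3) + g (1,4) + g (2,3) + g (2,4) + g (3,4)"
  by (simp add: index_pairs_def add.assoc)

text \<open>The numerator of the moment map, for arbitrary weights on the vertices \<open>e\<^sub>i + e\<^sub>j\<close> of the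
  octahedron: the \<open>k\<close>-th component collects the three pairs that contain \<open>k\<close>.\<close>

lemma weighted_vertex_sum:
  fixes p :: "4 \<Rightarrow> 4 \<Rightarrow> real"
  shows "(\<Sum>(i,j)\<in>index_pairs. p i j *\<^sub>R (axis i 1 + axis j 1)) =
    (vector [p 1 2 + p 1 3 + p 1 4, p 1 2 + p 2 3 + p 2 4,
             p 1 3 + p 2 3 + p 3 4, p 1 4 + p 2 4 + p 3 4] :: real^4)"
  by (simp add: sum_index_pairs vec_eq_iff forall_4 axis_def)

text \<open>Among the six pairs, only \<open>{2,3}\<close> is counted twice in \<open>\<mu>\<^sub>2 + \<mu>\<^sub>3\<close>, so without its
  contribution this sum is at most the total mass 1.\<close>

lemma moment_fibre_subset_M23:
  assumes "Q $ 2 + Q $ 3 > 1"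
  shows "moment_fibre Q \<subseteq> M23"
proof
  fix L assume "L \<in> moment_fibre Q"
  then have G: "L \<in> G42" and \<mu>: "moment_map L = Q"
    by (auto simp: moment_fibre_def)
  define p where "p i j = (cmod (plucker i j L))\<^sup>2" for i j
  define S where "S = (\<Sum>(i,j)\<in>index_pairs. p i j)"
  have S: "S = p 1 2 + p 1 3 + p 1 4 + p 2 3 + p 2 4 + p 3 4"
    by (simp add: S_def sum_index_pairs)
  have p: "p i j \<ge> 0" for i j
    by (simp add: p_def)
  have "Q = (vector [p 1 2 + p 1 3 + p 1 4, p 1 2 + p 2 3 + p 2 4,
             p 1 3 + p 2 3 + p 3 4, p 1 4 + p 2 4 + p 3 4] :: real^4) /\<^sub>R S"
    using \<mu> unfolding moment_map_def weighted_vertex_sum S_def p_def by simp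
  then have Q: "Q $ 2 + Q $ 3 = (p 1 2 + 2 * p 2 3 + p 2 4 + p 1 3 + p 3 4) / S"
    by (simp add: divide_inverse algebra_simps)
  have "plucker 2 3 L \<noteq> 0"
  proof
    assume "plucker 2 3 L = 0"
    then have "p 2 3 = 0" by (simp add: p_def)
    then have "Q $ 2 + Q $ 3 \<le> 1"
      unfolding Q S using p[of 1 2] p[of 1 3] p[of 1 4] p[of 2 4] p[of 3 4]
      by (intro divide_le_eq_1[THEN iffD2]) linarith
    with assms show False by simp
  qed
  with G show "L \<in> M23" by (simp add: M23_def)
qed

definition sqmod :: "real^8 \<Rightarrow> 4 \<Rightarrow> real"
  where "sqmod x k = (cmod (cplx x $ k))\<^sup>2"

definition sqdet :: "real^8 \<Rightarrow> real"
  where "sqdet x = (cmod (cplx x $ 1 * cplx x $ 4 - cplx x $ 2 * cplx x $ 3))\<^sup>2"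

lemma sqmod_nonneg [simp]: "sqmod x k \<ge> 0" and sqdet_nonneg [simp]: "sqdet x \<ge> 0"
  by (simp_all add: sqmod_def sqdet_def)

lemma sqmod_uv: "sqmod x k = (u x k)\<^sup>2 + (v x k)\<^sup>2"
  by (simp add: sqmod_def u_def v_def cmod_power2)

lemma f_eq_sqmod:
  "f1 x = sqmod x 1 + sqmod x 2 - sqmod x 3 - sqmod x 4"
  "f2 x = 5 * sqmod x 1 + sqmod x 3 - 4 * sqmod x 4"
  "f3 x = 4 * sqmod x 1 + sqmod x 3 - 3 * sqmod x 4 + sqdet x"
  by (simp_all add: f1_def f2_def f3_def sqmod_uv sqdet_def cmod_power2 flip: Apart_Bpart)

lemma chart_plane_G42: "chart_plane x \<in> G42"
  using chart_plane_M23[of x] by (simp add: M23_def)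

lemma moment_map_chart_plane:
  "moment_map (chart_plane x) =
    (vector [sqmod x 1 + sqmod x 3 + sqdet x, 1 + sqmod x 3 + sqmod x 4,
             1 + sqmod x 1 + sqmod x 2, sqmod x 2 + sqmod x 4 + sqdet x] :: real^4) /\<^sub>R
    (1 + sqmod x 1 + sqmod x 2 + sqmod x 3 + sqmod x 4 + sqdet x)"
  unfolding moment_map_eq[OF chart_plane_G42 chart_plane_def[symmetric]] weighted_vertex_sum
  by (simp add: sum_index_pairs minor_eq sqmod_def sqdet_def vec_eq_iff forall_4 algebra_simps)

text \<open>Since the denominator is positive, clearing it leaves a linear system in the squared moduli.
  The three level equations are an invertible linear recombination of it.\<close>

lemma chart_plane_in_fibre_iff:
  "chart_plane x \<in> moment_fibre (vector [1/3, 5/9, 5/9, 5/9]) \<longleftrightarrow> f1 x = 0 \<and> f2 x = -1 \<and> f3 x = 0"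
proof -
  have pos: "1 + sqmod x 1 + sqmod x 2 + sqmod x 3 + sqmod x 4 + sqdet x > 0"
    using sqmod_nonneg[of x 1] sqmod_nonneg[of x 2] sqmod_nonneg[of x 3] sqmod_nonneg[of x 4]
      sqdet_nonneg[of x] by linarith
  show ?thesis
    using pos
    by (simp add: moment_fibre_def chart_plane_G42 moment_map_chart_plane f_eq_sqmod
        vec_eq_iff forall_4 field_simps) linarith
qed

text \<open>The weight of the complex coordinate \<open>a\<^sub>k\<close> acts on both of its real coordinates.\<close>

definition double_weights :: "real^4 \<Rightarrow> real^8"
  where "double_weights \<tau> = vector [\<tau>$1, \<tau>$1, \<tau>$2, \<tau>$2, \<tau>$3, \<tau>$3, \<tau>$4, \<tau>$4]"

text \<open>An exponential is used instead of a straight line so that \<^const>\<open>sqdet\<close> also scales: both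
  products \<open>a\<^sub>1a\<^sub>4\<close> and \<open>a\<^sub>2a\<^sub>3\<close> then get the same factor as soon as
  \<open>\<tau>\<^sub>1 + \<tau>\<^sub>4 = \<tau>\<^sub>2 + \<tau>\<^sub>3\<close>.\<close>

definition torus_flow :: "real^4 \<Rightarrow> real^8 \<Rightarrow> real \<Rightarrow> real^8"
  where "torus_flow \<tau> x t = (\<chi> i. exp (t * double_weights \<tau> $ i) * x $ i)"

lemma cplx_torus_flow: "cplx (torus_flow \<tau> x t) $ k = exp (t * \<tau> $ k) *\<^sub>R (cplx x $ k)"
  using exhaust_4[of k]
  by (auto simp: cplx_def torus_flow_def double_weights_def complex_eq_iff)

lemma sqmod_torus_flow: "sqmod (torus_flow \<tau> x t) k = exp (2 * t * \<tau> $ k) * sqmod x k"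
  by (simp add: sqmod_def cplx_torus_flow power_mult_distrib exp_double[symmetric] mult.assoc)

lemma sqdet_torus_flow:
  assumes "\<tau>$1 + \<tau>$4 = \<tau>$2 + \<tau>$3"
  shows "sqdet (torus_flow \<tau> x t) = exp (2 * t * (\<tau>$1 + \<tau>$4)) * sqdet x"
proof -
  have e: "exp (t * \<tau>$1) * exp (t * \<tau>$4) = exp (t * (\<tau>$1 + \<tau>$4))"
    "exp (t * \<tau>$2) * exp (t * \<tau>$3) = exp (t * (\<tau>$1 + \<tau>$4))"
    by (simp_all add: assms flip: exp_add distrib_left)
  have "cplx (torus_flow \<tau> x t) $ 1 * cplx (torus_flow \<tau> x t) $ 4
      - cplx (torus_flow \<tau> x t) $ 2 * cplx (torus_flow \<tau> x t) $ 3
     = exp (t * (\<tau>$1 + \<tau>$4)) *\<^sub>R (cplx x $ 1 * cplx x $ 4 - cplx x $ 2 * cplx x $ 3)"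
    by (simp only: cplx_torus_flow mult_scaleR_left mult_scaleR_right scaleR_scaleR e scaleR_diff_right)
      (simp add: e mult.commute)
  then show ?thesis
    by (simp add: sqdet_def power_mult_distrib exp_double[symmetric] mult.assoc)
qed

lemma torus_flow_has_vector_derivative:
  "(torus_flow \<tau> x has_vector_derivative (\<chi> i. double_weights \<tau> $ i * x $ i)) (at 0)"
  unfolding has_vector_derivative_def torus_flow_def
  by (subst has_derivative_componentwise_within)
    (auto simp: Basis_vec_def inner_axis intro!: derivative_eq_intros)

lemma torus_flow_0 [simp]: "torus_flow \<tau> x 0 = x"
  by (simp add: torus_flow_def vec_eq_iff)

text \<open>By the chain rule, the Jacobian applied to the velocity of the flow is the derivative at time 0
  of \<open>f\<close> along the flow, where each squared modulus is just an exponential function of time. So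
  the entries of the Jacobian itself need not be computed.\<close>

lemma jacobian_torus_flow:
  assumes "\<tau>$1 + \<tau>$4 = \<tau>$2 + \<tau>$3"
  shows "jacobian f_vec (at x) *v (\<chi> i. double_weights \<tau> $ i * x $ i) = 2 *\<^sub>R
    vector [\<tau>$1 * sqmod x 1 + \<tau>$2 * sqmod x 2 - \<tau>$3 * sqmod x 3 - \<tau>$4 * sqmod x 4,
            5 * \<tau>$1 * sqmod x 1 + \<tau>$3 * sqmod x 3 - 4 * \<tau>$4 * sqmod x 4,
            4 * \<tau>$1 * sqmod x 1 + \<tau>$3 * sqmod x 3 - 3 * \<tau>$4 * sqmod x 4
              + (\<tau>$1 + \<tau>$4) * sqdet x]"
  (is "?J *v ?w = 2 *\<^sub>R ?r")
proof -
  have "(f_vec has_derivative (\<lambda>h. ?J *v h)) (at (torus_flow \<tau> x 0))"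
    using f_vec_differentiable[of x] jacobian_works by auto
  from diff_chain_at[OF torus_flow_has_vector_derivative[unfolded has_vector_derivative_def] this]
  have "((f_vec \<circ> torus_flow \<tau> x) has_vector_derivative ?J *v ?w) (at 0)"
    by (simp add: has_vector_derivative_def o_def matrix_vector_mult_scaleR)
  then have 1: "((\<lambda>t. f_vec (torus_flow \<tau> x t) $ k) has_real_derivative (?J *v ?w) $ k) (at 0)" for k
    unfolding o_def has_real_derivative_iff_has_vector_derivative
    using bounded_linear.has_vector_derivative[OF bounded_linear_vec_nth] by blast
  have 2: "((\<lambda>t. f_vec (torus_flow \<tau> x t) $ k) has_real_derivative (2 *\<^sub>R ?r) $ k) (at 0)" for k
    using exhaust_3[of k]
    by (auto simp: f_vec_def f_eq_sqmod sqmod_torus_flow sqdet_torus_flow[OF assms] algebra_simps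
        intro!: derivative_eq_intros)
  show ?thesis
    using DERIV_unique[OF 1 2] by (simp add: vec_eq_iff)
qed

lemma rank_eq_nrows_iff:
  fixes A :: "real^'n^'m"
  shows "rank A = CARD('m) \<longleftrightarrow> (\<forall>c. c v* A = 0 \<longrightarrow> c = 0)"
  using full_rank_injective[of "transpose A"] matrix_left_invertible_injective[of "transpose A"]
    matrix_left_invertible_ker[of "transpose A"]
  by (simp add: rank_transpose)

text \<open>
  Write \<open>c\<^sub>1, \<dots>, c\<^sub>4\<close> for the coefficients of \<open>x\<^sub>1, \<dots>, x\<^sub>4\<close> in
  \<open>l\<^sub>1f\<^sub>1 + l\<^sub>2f\<^sub>2 + l\<^sub>3f\<^sub>3\<close>. The hypotheses say \<open>c\<^sub>1x\<^sub>1 = c\<^sub>4x\<^sub>4\<close>, \<open>c\<^sub>2x\<^sub>2 = c\<^sub>3x\<^sub>3\<close>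
  and \<open>c\<^sub>2x\<^sub>2 + c\<^sub>4x\<^sub>4 + l\<^sub>3d = 0\<close>. The particular numbers in the functions give
  \<open>c\<^sub>1 + c\<^sub>4 = c\<^sub>2 + c\<^sub>3 = m\<close> with \<open>m = l\<^sub>2 + l\<^sub>3\<close>, so the first two equations make \<open>c\<^sub>4\<close> and
  \<open>c\<^sub>2\<close> nonnegative multiples of \<open>m\<close>. The third one then reads \<open>m K = 0\<close>, where \<open>K\<close> is a
  sum of nonnegative terms that do not all vanish on the level set.
\<close>

lemma covector_eq_0:
  fixes l1 l2 l3 x1 x2 x3 x4 d :: real
  assumes nonneg: "x1 \<ge> 0" "x2 \<ge> 0" "x3 \<ge> 0" "x4 \<ge> 0" "d \<ge> 0"
    and level: "x1 + x2 - x3 - x4 = 0" "5 * x1 + x3 - 4 * x4 = -1" "4 * x1 + x3 - 3 * x4 + d = 0"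
    and E1: "(l1 + 5 * l2 + 4 * l3) * x1 = (- l1 - 4 * l2 - 3 * l3) * x4"
    and E2: "l1 * x2 = (- l1 + l2 + l3) * x3"
    and E3: "l1 * x2 + (- l1 - 4 * l2 - 3 * l3) * x4 + l3 * d = 0"
  shows "l1 = 0 \<and> l2 = 0 \<and> l3 = 0"
proof -
  define m where "m = l2 + l3"
  define c where "c = - l1 - 4 * l2 - 3 * l3"
  \<comment> \<open>The level equations give \<open>4 x4 = 1 + 5 x1 + x3\<close> and \<open>x2 - x3 = x4 - x1\<close>; with
    \<open>x2 = x3 = 0\<close> they would force \<open>x1 = -1\<close>.\<close>
  have pos14: "x1 + x4 > 0" and pos23: "x2 + x3 > 0"
    using nonneg level by linarith+
  have "c * (x1 + x4) = m * x1" 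
    using E1 by (simp add: c_def m_def algebra_simps)
  then have c: "c = m * (x1 / (x1 + x4))"
    using pos14 by (simp add: field_simps)
  have "l1 * (x2 + x3) = m * x3" 
    using E2 by (simp add: m_def algebra_simps)
  then have l1: "l1 = m * (x3 / (x2 + x3))"
    using pos23 by (simp add: field_simps)
  have l3: "l3 = l1 + c + 4 * m"
    by (simp add: c_def m_def)
  define K where "K = x3 / (x2 + x3) * (x2 + d) + x1 / (x1 + x4) * (x4 + d) + 4 * d"
  have "m * K = l1 * x2 + c * x4 + l3 * d"
    unfolding K_def l3 c l1 by (simp only: algebra_simps)
  then have mK: "m * K = 0"
    using E3 by (simp add: c_def)
  have "x1 / (x1 + x4) * (x4 + d) \<ge> 0" "x3 / (x2 + x3) * (x2 + d) \<ge> 0"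
    using nonneg by simp_all
  moreover have "d > 0 \<or> x1 / (x1 + x4) * (x4 + d) > 0 \<or> x3 / (x2 + x3) * (x2 + d) > 0"
  proof (rule ccontr)
    assume n: "\<not> ?thesis"
    then have d: "d = 0" using nonneg by simp
    have x4: "x4 > 0" using nonneg level by linarith
    have "x1 = 0"
      using n nonneg x4 by (auto simp: d zero_less_mult_iff zero_less_divide_iff)
    \<comment> \<open>The level equations now leave the single point \<open>(x1, x2, x3, x4) = (0, 4, 3, 1)\<close>.\<close>
    with d level have "x3 > 0" "x2 > 0" by simp_all
    with n show False by (simp add: d)
  qed
  ultimately have "K > 0"
    using nonneg unfolding K_def by linarith
  with mK have "m = 0" by simp
  moreover from this have "l1 = 0" "c = 0"
    using l1 c by simp_all
  ultimately show ?thesis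
    using l3 m_def by (intro conjI) linarith+
qed

lemma rank_jacobian_f_vec:
  assumes "f1 x = 0" "f2 x = -1" "f3 x = 0"
  shows "rank (jacobian f_vec (at x)) = 3"
proof -
  let ?J = "jacobian f_vec (at x)"
  have "l = 0" if l: "l v* ?J = 0" for l
  proof -
    have orth: "l \<bullet> (?J *v h) = 0" for h
      using l by (simp add: dot_lmul_matrix[symmetric])
    \<comment> \<open>A basis of the weights with \<open>\<tau>$1 + \<tau>$4 = \<tau>$2 + \<tau>$3\<close>; the first two leave
      \<^term>\<open>sqdet x\<close> invariant, hence give equations between two moduli only.\<close>
    define \<tau>1 \<tau>2 \<tau>3 :: "real^4"
      where "\<tau>1 = vector [1, 0, 0, -1]" and "\<tau>2 = vector [0, 1, -1, 0]"
        and "\<tau>3 = vector [0, 1, 0, 1]"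
    note \<tau> = \<tau>1_def \<tau>2_def \<tau>3_def
    have "\<tau>1$1 + \<tau>1$4 = \<tau>1$2 + \<tau>1$3" "\<tau>2$1 + \<tau>2$4 = \<tau>2$2 + \<tau>2$3" "\<tau>3$1 + \<tau>3$4 = \<tau>3$2 + \<tau>3$3"
      by (simp_all add: \<tau>)
    note J = this[THEN jacobian_torus_flow[of _ x]]
    have "(l$1 + 5 * l$2 + 4 * l$3) * sqmod x 1 = (- l$1 - 4 * l$2 - 3 * l$3) * sqmod x 4"
      using orth[of "\<chi> i. double_weights \<tau>1 $ i * x $ i"] unfolding J
      by (simp add: \<tau> inner_vec_def sum_3 algebra_simps)
    moreover have "l$1 * sqmod x 2 = (- l$1 + l$2 + l$3) * sqmod x 3"
      using orth[of "\<chi> i. double_weights \<tau>2 $ i * x $ i"] unfolding J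
      by (simp add: \<tau> inner_vec_def sum_3 algebra_simps)
    moreover have "l$1 * sqmod x 2 + (- l$1 - 4 * l$2 - 3 * l$3) * sqmod x 4 + l$3 * sqdet x = 0"
      using orth[of "\<chi> i. double_weights \<tau>3 $ i * x $ i"] unfolding J
      by (simp add: \<tau> inner_vec_def sum_3 algebra_simps)
    ultimately have "l$1 = 0 \<and> l$2 = 0 \<and> l$3 = 0"
      using assms
      by (intro covector_eq_0[of "sqmod x 1" "sqmod x 2" "sqmod x 3" "sqmod x 4" "sqdet x"])
        (simp_all only: f_eq_sqmod sqmod_nonneg sqdet_nonneg)
    then show "l = 0" by (simp add: vec_eq_iff forall_3)
  qed
  then show ?thesis using rank_eq_nrows_iff[of ?J] by simp
qed

theorem theorem10:
  fixes Q :: "real^4" and M :: "(complex^4) set set"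
  assumes "Q = vector [1/3, 5/9, 5/9, 5/9]"
    and "M = moment_fibre Q"
  shows "M \<subseteq> M23
    \<and> chart_coords ` M = f1 -` {0} \<inter> f2 -` {-1} \<inter> f3 -` {0}
    \<and> (\<forall>x \<in> chart_coords ` M. rank (jacobian f_vec (at x)) = 3)"
proof -
  have sub: "M \<subseteq> M23"
    unfolding assms(2) by (rule moment_fibre_subset_M23) (simp add: assms(1))
  have fibre: "chart_plane x \<in> M \<longleftrightarrow> f1 x = 0 \<and> f2 x = -1 \<and> f3 x = 0" for x
    unfolding assms by (rule chart_plane_in_fibre_iff)
  have "chart_coords ` M = {x. chart_plane x \<in> M}"
  proof (intro subset_antisym subsetI)
    fix x assume "x \<in> chart_coords ` M"
    then obtain L where "L \<in> M" "x = chart_coords L" by blast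
    then show "x \<in> {x. chart_plane x \<in> M}"
      using sub chart_plane_coords[of L] by auto
  next
    fix x assume "x \<in> {x. chart_plane x \<in> M}"
    moreover have "x = chart_coords (chart_plane x)"
      by (simp add: chart_coords_def inv_f_f[OF inj_chart_plane])
    ultimately show "x \<in> chart_coords ` M" by blast
  qed
  then have level: "chart_coords ` M = f1 -` {0} \<inter> f2 -` {-1} \<inter> f3 -` {0}"
    by (auto simp: fibre)
  show ?thesis
    using sub level rank_jacobian_f_vec by auto
qed

end
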